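(* Let $n\ge 3$ be a natural number, $[n]=\{1,\dots,n\}$, and let $\{D_I\}$ be a family of positive real numbers indexed by all subsets $I\subset [n]$ with $\sharp I\ge 2$. There exists a positive-weighted tree $\mathcal{T}=(T,w)$ with $V(T)=[n]$ such that $D_I(\mathcal{T})=D_I$ for every $I\subset[n]$ with $\sharp I\ge 2$ if and only if the following three conditions hold: (i) the family $\{D_I\}_{I\subset[n],\,\sharp I=2}$ satisfies the $4$-point condition; (ii) the family $\{D_I\}_{I\subset[n],\,\sharp I=2}$ is median; (iii) for every $S\subset [n]$ with $\sharp S\ge 3$, $$D_S=\min_{X}\ \sum_{I\in X} D_I ,$$ where the minimum is over all sets $X$ of $2$-element subsets of $[n]$ such that $G_X$ is a tree and $L(G_X)\subset S\subset V(G_X)$.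
   Context: Graphs and trees are finite and simple; trees are connected. For a graph $G$, $V(G)$, $E(G)$ and $L(G)$ denote its sets of vertices, edges and leaves (vertices of degree $1$). $\sharp S$ is the cardinality of $S$, and $\subset$ allows equality. A positive-weighted tree $\mathcal{T}=(T,w)$ is a tree $T$ with a function $w:E(T)\to\mathbb{R}_{>0}$. For a subgraph $R$ of $T$, $w(R)$ is the sum of the weights of its edges. For $S\subset V(T)$ with $\sharp S\ge 2$, $$D_S(\mathcal{T})=\min\{w(R)\mid R \text{ a connected subgraph of } T \text{ with } S\subset V(R)\}.$$ $D_{i,j}$ is shorthand for $D_{\{i,j\}}$, with the convention $D_{i,i}=0$. $4$-point condition: for all $a,b,c,d\in[n]$ (not necessarily distinct), among the three numbers $D_{a,b}+D_{c,d}$, $D_{a,c}+D_{b,d}$, $D_{a,d}+D_{b,c}$ the maximum is attained at least twice. Median: for any distinct $a,b,c\in[n]$ there exists a unique $m\in[n]$ such that $D_{i,j}=D_{i,m}+D_{j,m}$ for all distinct $i,j\in\{a,b,c\}$. For a set $X$ of $2$-element subsets of $[n]$, $G_X$ is the graph with edge set $X$ and vertex set $\bigcup_{I\in X} I$. *)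

theory Defs
  imports Complex_Main
begin

text \<open>
  A graph is given by its vertex set \<open>V\<close> and its edge set \<open>E\<close>, edges being two-element sets of
  vertices.
\<close>

definition simple_graph :: "'a set \<Rightarrow> 'a set set \<Rightarrow> bool" where
  "simple_graph V E \<longleftrightarrow> finite V \<and> (\<forall>e\<in>E. e \<subseteq> V \<and> card e = 2)"

definition connected_graph :: "'a set \<Rightarrow> 'a set set \<Rightarrow> bool" where
  "connected_graph V E \<longleftrightarrow>
     simple_graph V E \<and> V \<noteq> {} \<and> (\<forall>u\<in>V. \<forall>v\<in>V. (u, v) \<in> {(x, y). {x, y} \<in> E}\<^sup>*)"

definition is_cycle :: "'a set set \<Rightarrow> 'a list \<Rightarrow> bool" where
  "is_cycle E vs \<longleftrightarrow>
     3 \<le> length vs \<and> distinct vs \<and>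
     (\<forall>i<length vs. {vs ! i, vs ! (Suc i mod length vs)} \<in> E)"

definition is_tree :: "'a set \<Rightarrow> 'a set set \<Rightarrow> bool" where
  "is_tree V E \<longleftrightarrow> connected_graph V E \<and> (\<nexists>vs. is_cycle E vs)"

definition leaves :: "'a set \<Rightarrow> 'a set set \<Rightarrow> 'a set" where
  "leaves V E = {v \<in> V. card {e \<in> E. v \<in> e} = 1}"

definition positive_weighted_tree :: "'a set \<Rightarrow> 'a set set \<Rightarrow> ('a set \<Rightarrow> real) \<Rightarrow> bool" where
  "positive_weighted_tree V E w \<longleftrightarrow> is_tree V E \<and> (\<forall>e\<in>E. 0 < w e)"

text \<open>
  The weights \<open>w(R)\<close> of the connected subgraphs \<open>R = (V', E')\<close> of \<open>(V, E)\<close> with \<open>S \<subseteq> V'\<close>.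
\<close>

definition connecting_weights ::
    "'a set \<Rightarrow> 'a set set \<Rightarrow> ('a set \<Rightarrow> real) \<Rightarrow> 'a set \<Rightarrow> real set" where
  "connecting_weights V E w S =
     {sum w E' | V' E'. V' \<subseteq> V \<and> E' \<subseteq> E \<and> connected_graph V' E' \<and> S \<subseteq> V'}"

text \<open>
  \<open>tree_weight V E w S\<close> is \<open>D\<^sub>S(\<T>)\<close>.  The minimum is over a finite nonempty set whenever
  \<open>(V, E)\<close> is a tree and \<open>S \<subseteq> V\<close>; see the two lemmas that follow.
\<close>

definition tree_weight :: "'a set \<Rightarrow> 'a set set \<Rightarrow> ('a set \<Rightarrow> real) \<Rightarrow> 'a set \<Rightarrow> real" where
  "tree_weight V E w S = Min (connecting_weights V E w S)"

lemma finite_edges: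
  assumes "simple_graph V E"
  shows "finite E"
proof (rule finite_subset)
  show "E \<subseteq> Pow V" using assms by (auto simp: simple_graph_def)
  show "finite (Pow V)" using assms by (simp add: simple_graph_def)
qed

lemma finite_connecting_weights:
  assumes "simple_graph V E"
  shows "finite (connecting_weights V E w S)"
proof (rule finite_subset)
  show "connecting_weights V E w S \<subseteq> sum w ` Pow E"
    by (auto simp: connecting_weights_def)
  show "finite (sum w ` Pow E)" using finite_edges[OF assms] by simp
qed

lemma connecting_weights_nonempty:
  assumes "connected_graph V E" "S \<subseteq> V"
  shows "connecting_weights V E w S \<noteq> {}"
  using assms by (auto simp: connecting_weights_def)

text \<open>\<open>pair_dist D i j\<close> is \<open>D\<^bsub>i,j\<^esub>\<close>, with the convention \<open>D\<^bsub>i,i\<^esub> = 0\<close>.\<close>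

definition pair_dist :: "('a set \<Rightarrow> real) \<Rightarrow> 'a \<Rightarrow> 'a \<Rightarrow> real" where
  "pair_dist D i j = (if i = j then 0 else D {i, j})"

definition max_attained_twice :: "real \<Rightarrow> real \<Rightarrow> real \<Rightarrow> bool" where
  "max_attained_twice x y z \<longleftrightarrow>
     (let m = Max {x, y, z} in (x = m \<and> y = m) \<or> (x = m \<and> z = m) \<or> (y = m \<and> z = m))"

definition four_point :: "'a set \<Rightarrow> ('a set \<Rightarrow> real) \<Rightarrow> bool" where
  "four_point A D \<longleftrightarrow>
     (\<forall>a\<in>A. \<forall>b\<in>A. \<forall>c\<in>A. \<forall>d\<in>A.
        max_attained_twice
          (pair_dist D a b + pair_dist D c d)
          (pair_dist D a c + pair_dist D b d)
          (pair_dist D a d + pair_dist D b c))"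

definition median_family :: "'a set \<Rightarrow> ('a set \<Rightarrow> real) \<Rightarrow> bool" where
  "median_family A D \<longleftrightarrow>
     (\<forall>a\<in>A. \<forall>b\<in>A. \<forall>c\<in>A. a \<noteq> b \<and> a \<noteq> c \<and> b \<noteq> c \<longrightarrow>
        (\<exists>!m. m \<in> A \<and>
           (\<forall>i\<in>{a, b, c}. \<forall>j\<in>{a, b, c}. i \<noteq> j \<longrightarrow>
              pair_dist D i j = pair_dist D i m + pair_dist D j m)))"

text \<open>
  The sets \<open>X\<close> of two-element subsets of \<open>A\<close> such that \<open>G\<^sub>X = (\<Union>X, X)\<close> is a tree with
  \<open>L(G\<^sub>X) \<subseteq> S \<subseteq> V(G\<^sub>X)\<close>.
  There are finitely many, and at least one if \<open>S \<subseteq> A\<close> has three or more elements (a star on \<open>S\<close>).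
\<close>

definition steiner_trees :: "'a set \<Rightarrow> 'a set \<Rightarrow> 'a set set set" where
  "steiner_trees A S =
     {X. (\<forall>I\<in>X. I \<subseteq> A \<and> card I = 2) \<and> is_tree (\<Union>X) X \<and>
         leaves (\<Union>X) X \<subseteq> S \<and> S \<subseteq> \<Union>X}"

lemma finite_steiner_trees:
  assumes "finite A"
  shows "finite (steiner_trees A S)"
proof (rule finite_subset)
  show "steiner_trees A S \<subseteq> Pow (Pow A)" by (auto simp: steiner_trees_def)
  show "finite (Pow (Pow A))" using assms by simp
qed

end

theory Submission
  imports Defs
begin

text \<open>
  Condition (iii) and conditions (i), (ii) play separate parts.

  Condition (iii) holds in every weighted tree for the numbers \<open>D\<^sub>S(\<T>)\<close>
  (\<open>tree_weight_eq_Min_steiner\<close>).  A subtree of least weight among those that contain \<open>S\<close> has all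
  its leaves in \<open>S\<close>, since a leaf outside \<open>S\<close> could be cut off; its edge set is therefore one of the
  admissible \<open>X\<close>, and the sum over it is at most \<open>D\<^sub>S(\<T>)\<close>.  Conversely, if each pair \<open>I\<close> of an
  admissible \<open>X\<close> is replaced by a subtree of weight \<open>D\<^sub>I(\<T>)\<close> that joins it, the union of these
  subtrees is connected and contains \<open>S\<close>.  So (iii) says that the numbers \<open>D\<^sub>S\<close> with three or more
  points in \<open>S\<close> are computed from the pairs as a tree would compute them, and what is left is to see
  that (i) and (ii) characterise the path metrics of weighted trees all of whose vertices are labelled.

  Both directions of this are inductions on pendant vertices, that is, vertices \<open>v\<close> joined to the rest
  only through one neighbour \<open>u\<close>, so that \<open>d v x = d v u + d u x\<close> for all \<open>x \<noteq> v\<close>.  A tree with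
  more than one vertex has a leaf, namely the end of a longest path (\<open>tree_leaf_exists\<close>), and
  attaching a pendant vertex preserves the four-point condition and the existence of medians
  (\<open>median_tree_metric_add_pendant\<close>).  In the other direction, the vertex \<open>v\<close> farthest from an
  arbitrary base point is pendant at the vertex \<open>u\<close> nearest to it
  (\<open>median_tree_metric_pendant_exists\<close>): the median of \<open>v\<close>, \<open>u\<close>, \<open>x\<close> can only be \<open>v\<close> or \<open>u\<close>, and
  the four-point condition prevents an extremal vertex from lying between two others.  Removing \<open>v\<close>
  and realising the remaining metric by induction gives the tree, with weights \<open>D\<close> on its edges.
\<close>

section \<open>Connected graphs and pendant vertices\<close>

abbreviation adjacent :: "'a set set \<Rightarrow> ('a \<times> 'a) set" where
  "adjacent E \<equiv> {(x, y). {x, y} \<in> E}"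

lemma sym_adjacent_rtrancl: "(x, y) \<in> (adjacent E)\<^sup>* \<Longrightarrow> (y, x) \<in> (adjacent E)\<^sup>*"
  by (rule symD[OF sym_rtrancl]) (auto simp: sym_def insert_commute)

lemma adjacent_rtrancl_mono:
  "(x, y) \<in> (adjacent E)\<^sup>* \<Longrightarrow> E \<subseteq> F \<Longrightarrow> (x, y) \<in> (adjacent F)\<^sup>*"
  by (rule rev_subsetD[OF _ rtrancl_mono]) auto

lemma connected_graphI:
  assumes "simple_graph V E" "c \<in> V" "\<And>x. x \<in> V \<Longrightarrow> (c, x) \<in> (adjacent E)\<^sup>*"
  shows "connected_graph V E"
  unfolding connected_graph_def
  using assms sym_adjacent_rtrancl[of c _ E] by (blast intro: rtrancl_trans)

lemma connected_graph_ex_edge: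
  assumes "connected_graph V E" "v \<in> V" "V \<noteq> {v}"
  shows "\<exists>x. x \<noteq> v \<and> {x, v} \<in> E"
proof -
  obtain y where y: "y \<in> V" "y \<noteq> v" using assms(2,3) by blast
  have "(v, y) \<in> (adjacent E)\<^sup>*" using assms y by (auto simp: connected_graph_def)
  then obtain x where "{v, x} \<in> E" using y(2) by (cases rule: converse_rtranclE) auto
  moreover then have "x \<noteq> v" using assms(1) by (auto simp: connected_graph_def simple_graph_def)
  ultimately show ?thesis by (auto simp: insert_commute)
qed

lemma connected_graph_singleton: "connected_graph {v} {}"
  by (auto simp: connected_graph_def simple_graph_def)

lemma connected_graph_add_pendant:
  assumes "connected_graph V E" "u \<in> V" "v \<notin> V"
  shows "connected_graph (insert v V) (insert {u, v} E)"
proof (rule connected_graphI)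
  show "simple_graph (insert v V) (insert {u, v} E)"
    using assms by (auto simp: connected_graph_def simple_graph_def card_2_iff)
  show "u \<in> insert v V" using assms by simp
  show "(u, x) \<in> (adjacent (insert {u, v} E))\<^sup>*" if "x \<in> insert v V" for x
  proof (cases "x = v")
    case True
    then show ?thesis by blast
  next
    case False
    then have "(u, x) \<in> (adjacent E)\<^sup>*" using assms that by (auto simp: connected_graph_def)
    then show ?thesis by (rule adjacent_rtrancl_mono) blast
  qed
qed

text \<open>
  A walk can enter and leave the pendant vertex \<open>v\<close> only through \<open>u\<close>, so the visits to \<open>v\<close> can be cut
  out of it.
\<close>

lemma connected_graph_remove_pendant:
  assumes "connected_graph V E" "v \<in> V" "{e \<in> E. v \<in> e} = {{u, v}}"
  shows "connected_graph (V - {v}) (E - {{u, v}})" and "u \<in> V - {v}"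
proof -
  have sg: "simple_graph V E" using assms(1) by (simp add: connected_graph_def)
  have uv: "{u, v} \<in> E" using assms(3) by blast
  then have "u \<noteq> v" "u \<in> V" using sg by (auto simp: simple_graph_def)
  then show u: "u \<in> V - {v}" by simp
  have edge: "e = {u, v}" if "e \<in> E" "v \<in> e" for e using assms(3) that by blast
  show "connected_graph (V - {v}) (E - {{u, v}})"
  proof (rule connected_graphI)
    show "simple_graph (V - {v}) (E - {{u, v}})"
      using sg edge unfolding simple_graph_def by blast
    show "u \<in> V - {v}" by (rule u)
    fix x assume x: "x \<in> V - {v}"
    have "(u, x) \<in> (adjacent E)\<^sup>*" using assms(1) u x by (auto simp: connected_graph_def)
    \<comment> \<open>Along the walk, \<open>v\<close> is read as \<open>u\<close>; steps between the two then become stationary.\<close>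
    then have "(u, if x = v then u else x) \<in> (adjacent (E - {{u, v}}))\<^sup>*"
    proof (induction rule: rtrancl_induct)
      case base
      then show ?case by simp
    next
      case (step y z)
      have yz: "{y, z} \<in> E" using step.hyps by simp
      show ?case
      proof (cases "y = v \<or> z = v")
        case True
        then have "{y, z} = {u, v}" using edge[OF yz] by blast
        then have "(y = v \<and> z = u) \<or> (y = u \<and> z = v)" by (auto simp: doubleton_eq_iff)
        then show ?thesis by auto
      next
        case False
        then have "(y, z) \<in> adjacent (E - {{u, v}})" using yz by (auto simp: doubleton_eq_iff)
        moreover have "(u, y) \<in> (adjacent (E - {{u, v}}))\<^sup>*" using step.IH False by simp
        ultimately show ?thesis using False by (simp add: rtrancl_into_rtrancl)
      qed
    qed
    then show "(u, x) \<in> (adjacent (E - {{u, v}}))\<^sup>*" using x by simp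
  qed
qed

section \<open>Building trees by attaching pendant vertices\<close>

lemma is_cycle_mono: "is_cycle E vs \<Longrightarrow> E \<subseteq> F \<Longrightarrow> is_cycle F vs"
  by (auto simp: is_cycle_def)

lemma is_tree_singleton: "is_tree {v} {}"
  by (force simp: is_tree_def connected_graph_singleton is_cycle_def)

lemma connected_subgraph_is_tree:
  assumes "is_tree V E" "connected_graph V' E'" "E' \<subseteq> E"
  shows "is_tree V' E'"
  using assms is_cycle_mono[of E' _ E] by (auto simp: is_tree_def)

text \<open>
  No cycle passes through the new vertex: both of its neighbours on the cycle would be \<open>u\<close>, but a cycle
  has at least three distinct vertices.
\<close>

lemma is_tree_add_pendant:
  assumes "is_tree V E" "u \<in> V" "v \<notin> V"
  shows "is_tree (insert v V) (insert {u, v} E)"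
proof -
  have conn: "connected_graph V E" using assms(1) by (simp add: is_tree_def)
  then have sg: "simple_graph V E" by (simp add: connected_graph_def)
  have "\<not> is_cycle (insert {u, v} E) vs" for vs
  proof
    assume cyc: "is_cycle (insert {u, v} E) vs"
    let ?L = "length vs"
    have L: "3 \<le> ?L" and dist: "distinct vs"
      and step: "\<And>i. i < ?L \<Longrightarrow> {vs ! i, vs ! (Suc i mod ?L)} \<in> insert {u, v} E"
      using cyc by (auto simp: is_cycle_def)
    have nb: "x = u" if "{x, v} \<in> insert {u, v} E" for x
      using that sg assms(3) by (auto simp: simple_graph_def doubleton_eq_iff)
    show False
    proof (cases "v \<in> set vs")
      case False
      have "{vs ! i, vs ! (Suc i mod ?L)} \<in> E" if i: "i < ?L" for i
      proof -
        have "Suc i mod ?L < ?L" using L by (intro mod_less_divisor) linarith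
        then have "vs ! i \<in> set vs" "vs ! (Suc i mod ?L) \<in> set vs" using i by (auto intro: nth_mem)
        then have "vs ! i \<noteq> v" "vs ! (Suc i mod ?L) \<noteq> v" using False by blast+
        then show ?thesis using step[OF i] by (auto simp: doubleton_eq_iff)
      qed
      then have "is_cycle E vs" using L dist by (simp add: is_cycle_def)
      then show False using assms(1) by (auto simp: is_tree_def)
    next
      case True
      then obtain i where i: "i < ?L" "vs ! i = v" by (auto simp: in_set_conv_nth)
      \<comment> \<open>\<open>j\<close> and \<open>k\<close> are the cyclic predecessor and successor of the position \<open>i\<close> of \<open>v\<close>.\<close>
      define j where "j = (if i = 0 then ?L - 1 else i - 1)"
      define k where "k = (if Suc i = ?L then 0 else Suc i)"
      have j: "j < ?L" "Suc j mod ?L = i" using i L by (auto simp: j_def)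
      have k: "k < ?L" "Suc i mod ?L = k" using i L by (auto simp: k_def)
      have "vs ! k = u" using step[OF i(1)] i(2) k(2) nb[of "vs ! k"] by (simp add: insert_commute)
      moreover have "vs ! j = u" using step[OF j(1)] i(2) j(2) nb[of "vs ! j"] by simp
      moreover have "j \<noteq> k" using i L by (auto simp: j_def k_def split: if_splits)
      ultimately show False using dist j(1) k(1) nth_eq_iff_index_eq by metis
    qed
  qed
  then show ?thesis using connected_graph_add_pendant[OF conn assms(2,3)] by (simp add: is_tree_def)
qed

text \<open>
  The first vertex \<open>v\<close> of a longest path is a leaf: by maximality its neighbours all lie on the path, and
  a neighbour beyond the second vertex would close a cycle with the part of the path leading up to it.
\<close>

lemma tree_leaf_exists:
  assumes "is_tree V E" "\<And>r. V \<noteq> {r}"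
  obtains u v where "v \<in> V" "{e \<in> E. v \<in> e} = {{u, v}}"
proof -
  have conn: "connected_graph V E" using assms(1) by (simp add: is_tree_def)
  then have sg: "simple_graph V E" by (simp add: connected_graph_def)
  then have fin: "finite V" by (simp add: simple_graph_def)
  define path where "path p \<longleftrightarrow> distinct p \<and> set p \<subseteq> V \<and> p \<noteq> [] \<and>
    (\<forall>i. Suc i < length p \<longrightarrow> {p ! i, p ! Suc i} \<in> E)" for p
  obtain x where "x \<in> V" using conn by (auto simp: connected_graph_def)
  then have "path [x]" by (simp add: path_def)
  moreover have "length p \<le> card V" if "path p" for p
    using that fin by (metis path_def card_mono distinct_card)
  ultimately obtain p where p: "path p" and max: "\<And>q. path q \<Longrightarrow> length q \<le> length p"
    using ex_has_greatest_nat[of path "[x]" length "Suc (card V)"] by (auto simp: less_Suc_eq_le)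
  obtain v q where vq: "p = v # q" using p by (cases p) (auto simp: path_def)
  have v: "v \<in> V" "v \<notin> set q" using p vq by (auto simp: path_def)
  have nb_in: "y \<in> set q" if "{y, v} \<in> E" for y
  proof (rule ccontr)
    assume "y \<notin> set q"
    moreover have "y \<noteq> v" "y \<in> V" using that sg by (auto simp: simple_graph_def)
    ultimately have "path (y # p)"
      using p that by (auto simp: path_def vq nth_Cons split: nat.split)
    then show False using max[of "y # p"] by simp
  qed
  have nb: "y = hd q" if "{y, v} \<in> E" for y
  proof (rule ccontr)
    assume "y \<noteq> hd q"
    moreover obtain i where i: "i < length q" "q ! i = y"
      using nb_in[OF \<open>{y, v} \<in> E\<close>] by (auto simp: in_set_conv_nth)
    ultimately have "0 < i" by (cases i) (auto simp: hd_conv_nth)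
    let ?c = "take (Suc (Suc i)) p"
    have len: "length ?c = Suc (Suc i)" using i vq by simp
    have "is_cycle E ?c"
      unfolding is_cycle_def
    proof (intro conjI allI impI)
      show "3 \<le> length ?c" using len \<open>0 < i\<close> by simp
      show "distinct ?c" using p by (simp add: path_def)
      fix k assume k: "k < length ?c"
      show "{?c ! k, ?c ! (Suc k mod length ?c)} \<in> E"
      proof (cases "k = Suc i")
        case True
        then show ?thesis using len vq i that by (simp add: insert_commute)
      next
        case False
        then have "Suc k < length ?c" "Suc k < length p" using k len i vq by auto
        then show ?thesis using p k len by (simp add: path_def)
      qed
    qed
    then show False using assms(1) by (auto simp: is_tree_def)
  qed
  obtain y where y: "{y, v} \<in> E" using connected_graph_ex_edge[OF conn v(1) assms(2)] by blast
  have "e = {y, v}" if e: "e \<in> E" "v \<in> e" for e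
  proof -
    have "card e = 2" using sg e(1) by (simp add: simple_graph_def)
    then obtain z where z: "e = {z, v}" using e(2) by (auto simp: card_2_iff)
    then have "z = y" using nb[OF e(1)[unfolded z]] nb[OF y] by (simp only:)
    then show ?thesis using z by (simp only:)
  qed
  then have "{e \<in> E. v \<in> e} = {{y, v}}" using y by blast
  then show ?thesis using that v(1) by blast
qed


lemma tree_induct [consumes 1, case_names singleton pendant]:
  assumes "is_tree V E"
    and "\<And>r. P {r} {}"
    and "\<And>V E u v. is_tree V E \<Longrightarrow> u \<in> V \<Longrightarrow> v \<notin> V \<Longrightarrow> P V E \<Longrightarrow>
           P (insert v V) (insert {u, v} E)"
  shows "P V E"
  using assms(1)
proof (induction "card V" arbitrary: V E rule: less_induct)
  case less
  have conn: "connected_graph V E" using less.prems by (simp add: is_tree_def)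
  then have sg: "simple_graph V E" by (simp add: connected_graph_def)
  show ?case
  proof (cases "\<exists>r. V = {r}")
    case True
    then obtain r where V: "V = {r}" by blast
    have "card e \<le> 1" if "e \<in> E" for e
      using sg that V card_mono[of "{r}" e] by (simp add: simple_graph_def)
    then have "E = {}" using sg unfolding simple_graph_def by fastforce
    then show ?thesis using V assms(2) by simp
  next
    case False
    then have "\<And>r. V \<noteq> {r}" by blast
    from tree_leaf_exists[OF less.prems this]
    obtain u v where v: "v \<in> V" and e: "{e \<in> E. v \<in> e} = {{u, v}}" .
    note rem = connected_graph_remove_pendant[OF conn v e]
    have tree: "is_tree (V - {v}) (E - {{u, v}})"
      using connected_subgraph_is_tree[OF less.prems rem(1)] by blast
    have "card (V - {v}) < card V"
      using v sg by (intro card_Diff1_less) (auto simp: simple_graph_def)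
    then have "P (V - {v}) (E - {{u, v}})" using tree by (rule less.hyps)
    then have "P (insert v (V - {v})) (insert {u, v} (E - {{u, v}}))"
      by (intro assms(3)[OF tree rem(2)]) auto
    moreover have "insert v (V - {v}) = V" using v by blast
    moreover have "insert {u, v} (E - {{u, v}}) = E" using e by blast
    ultimately show ?thesis by (simp only:)
  qed
qed

section \<open>Weights of minimal connected subgraphs\<close>

lemma tree_weight_le:
  assumes "simple_graph V E" "V' \<subseteq> V" "E' \<subseteq> E" "connected_graph V' E'" "S \<subseteq> V'"
  shows "tree_weight V E w S \<le> sum w E'"
  unfolding tree_weight_def
  using assms by (intro Min_le finite_connecting_weights) (auto simp: connecting_weights_def)

lemma tree_weight_attained:
  assumes "connected_graph V E" "S \<subseteq> V"
  obtains V' E' where "V' \<subseteq> V" "E' \<subseteq> E" "connected_graph V' E'" "S \<subseteq> V'"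
    "tree_weight V E w S = sum w E'"
proof -
  have "tree_weight V E w S \<in> connecting_weights V E w S"
    unfolding tree_weight_def
    using assms connecting_weights_nonempty[OF assms] finite_connecting_weights[of V E w S]
    by (intro Min_in) (auto simp: connected_graph_def)
  then show ?thesis using that unfolding connecting_weights_def by blast
qed

lemma tree_weight_singleton:
  assumes "connected_graph V E" "x \<in> V" "\<And>e. e \<in> E \<Longrightarrow> 0 < w e"
  shows "tree_weight V E w {x} = 0"
proof (rule antisym)
  have sg: "simple_graph V E" using assms(1) by (simp add: connected_graph_def)
  have "{x} \<subseteq> V" using assms(2) by simp
  then show "tree_weight V E w {x} \<le> 0"
    using tree_weight_le[OF sg _ _ connected_graph_singleton, of x "{x}" w] by simp
  obtain V' E' where E': "E' \<subseteq> E" "tree_weight V E w {x} = sum w E'"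
    using tree_weight_attained[OF assms(1) \<open>{x} \<subseteq> V\<close>] by metis
  have "0 \<le> sum w E'"
    using E'(1) assms(3) by (intro sum_nonneg) (blast intro: less_imp_le)
  then show "0 \<le> tree_weight V E w {x}" using E'(2) by simp
qed

text \<open>
  The edge alone is a connected subgraph.  Summed over the edges of a subtree, regarded as a set of
  pairs, this bounds the sum of the pair weights by the weight of the subtree.
\<close>

lemma tree_weight_edge_le:
  assumes "simple_graph V E" "e \<in> E"
  shows "tree_weight V E w e \<le> w e"
proof -
  have e: "e \<subseteq> V" "card e = 2" using assms by (auto simp: simple_graph_def)
  then obtain x y where xy: "e = {x, y}" "x \<noteq> y" by (auto simp: card_2_iff)
  have "connected_graph {y, x} {{x, y}}"
    using connected_graph_add_pendant[OF connected_graph_singleton, of x x y] xy by simp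
  then show ?thesis
    using tree_weight_le[OF assms(1) e(1), of "{e}" e w] assms(2) unfolding xy(1)
    by (simp add: insert_commute[of y x])
qed

lemma connected_subgraph_remove_pendant:
  assumes "simple_graph V E" "v \<notin> V"
    and "V' \<subseteq> insert v V" "E' \<subseteq> insert {u, v} E" "connected_graph V' E'" "v \<in> V'" "V' \<noteq> {v}"
  shows "{u, v} \<in> E'" "u \<in> V' - {v}" "V' - {v} \<subseteq> V" "E' - {{u, v}} \<subseteq> E"
    "connected_graph (V' - {v}) (E' - {{u, v}})"
proof -
  have at_v: "e = {u, v}" if "e \<in> E'" "v \<in> e" for e
    using assms(1,2,4) that by (auto simp: simple_graph_def)
  moreover obtain x where "{x, v} \<in> E'" using connected_graph_ex_edge[OF assms(5-7)] by blast
  ultimately show uv: "{u, v} \<in> E'" by (metis insertCI)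
  then have "{e \<in> E'. v \<in> e} = {{u, v}}" using at_v by blast
  from connected_graph_remove_pendant[OF assms(5,6) this]
  show "connected_graph (V' - {v}) (E' - {{u, v}})" "u \<in> V' - {v}" .
  show "V' - {v} \<subseteq> V" "E' - {{u, v}} \<subseteq> E" using assms(3,4) by auto
qed

text \<open>
  A subgraph that connects \<open>S\<close> and runs into the pendant vertex \<open>v \<notin> S\<close> only becomes lighter when \<open>v\<close> is
  cut off.
\<close>

lemma tree_weight_avoiding_pendant:
  assumes conn: "connected_graph V E" and u: "u \<in> V" and v: "v \<notin> V" and S: "S \<subseteq> V" "S \<noteq> {}"
    and w: "\<And>e. e \<in> insert {u, v} E \<Longrightarrow> 0 < w e"
  shows "tree_weight (insert v V) (insert {u, v} E) w S = tree_weight V E w S"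
proof (rule antisym)
  note conn' = connected_graph_add_pendant[OF conn u v]
  have sg: "simple_graph V E" and sg': "simple_graph (insert v V) (insert {u, v} E)"
    using conn conn' by (auto simp: connected_graph_def)
  obtain V1 E1 where 1: "V1 \<subseteq> V" "E1 \<subseteq> E" "connected_graph V1 E1" "S \<subseteq> V1"
    "tree_weight V E w S = sum w E1"
    using tree_weight_attained[OF conn S(1)] by blast
  then show "tree_weight (insert v V) (insert {u, v} E) w S \<le> tree_weight V E w S"
    using tree_weight_le[OF sg', of V1 E1 S w] by auto
  obtain V2 E2 where 2: "V2 \<subseteq> insert v V" "E2 \<subseteq> insert {u, v} E" "connected_graph V2 E2" "S \<subseteq> V2"
    "tree_weight (insert v V) (insert {u, v} E) w S = sum w E2"
    using tree_weight_attained[OF conn', of S w] S(1) by blast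
  have fin: "finite E2" using 2(3) finite_edges by (auto simp: connected_graph_def)
  show "tree_weight V E w S \<le> tree_weight (insert v V) (insert {u, v} E) w S"
  proof (cases "v \<in> V2")
    case False
    moreover have "{u, v} \<notin> E2"
      using 2(3) False unfolding connected_graph_def simple_graph_def by blast
    ultimately have "V2 \<subseteq> V" "E2 \<subseteq> E" using 2(1,2) by blast+
    then show ?thesis using tree_weight_le[OF sg] 2(3-5) by simp
  next
    case True
    have "V2 \<noteq> {v}" using S v 2(4) by blast
    note rem = connected_subgraph_remove_pendant[OF sg v 2(1-3) True this]
    have "tree_weight V E w S \<le> sum w (E2 - {{u, v}})"
      using tree_weight_le[OF sg rem(3-5)] 2(4) S(1) v by blast
    also have "\<dots> \<le> sum w E2"
      using fin w 2(2) by (intro sum_mono2) (auto intro: less_imp_le)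
    finally show ?thesis using 2(5) by simp
  qed
qed

text \<open>
  A connected subgraph containing \<open>v\<close> and a further vertex uses the edge \<open>{u, v}\<close>; without that edge it
  is a connected subgraph containing \<open>u\<close>.  Conversely the edge can be added to any such subgraph.
\<close>

lemma tree_weight_at_pendant:
  assumes conn: "connected_graph V E" and u: "u \<in> V" and v: "v \<notin> V" and S: "S \<subseteq> V" "S \<noteq> {}"
  shows "tree_weight (insert v V) (insert {u, v} E) w (insert v S) =
         w {u, v} + tree_weight V E w (insert u S)"
proof (rule antisym)
  note conn' = connected_graph_add_pendant[OF conn u v]
  have sg: "simple_graph V E" and sg': "simple_graph (insert v V) (insert {u, v} E)"
    using conn conn' by (auto simp: connected_graph_def)
  have "insert u S \<subseteq> V" using u S by blast
  then obtain V1 E1 where 1: "V1 \<subseteq> V" "E1 \<subseteq> E" "connected_graph V1 E1" "insert u S \<subseteq> V1"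
    "tree_weight V E w (insert u S) = sum w E1"
    using tree_weight_attained[OF conn] by metis
  have "connected_graph (insert v V1) (insert {u, v} E1)"
    using 1 v by (intro connected_graph_add_pendant) auto
  moreover have "insert v V1 \<subseteq> insert v V" "insert {u, v} E1 \<subseteq> insert {u, v} E"
    "insert v S \<subseteq> insert v V1" using 1 by auto
  ultimately have "tree_weight (insert v V) (insert {u, v} E) w (insert v S)
      \<le> sum w (insert {u, v} E1)"
    by (intro tree_weight_le[OF sg'])
  moreover have "{u, v} \<notin> E1"
    using 1(1,3) v unfolding connected_graph_def simple_graph_def by blast
  moreover have "finite E1" using 1(3) finite_edges by (auto simp: connected_graph_def)
  ultimately show "tree_weight (insert v V) (insert {u, v} E) w (insert v S)
      \<le> w {u, v} + tree_weight V E w (insert u S)"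
    using 1(5) by simp
  have "insert v S \<subseteq> insert v V" using S by blast
  then obtain V2 E2 where 2: "V2 \<subseteq> insert v V" "E2 \<subseteq> insert {u, v} E" "connected_graph V2 E2"
    "insert v S \<subseteq> V2" "tree_weight (insert v V) (insert {u, v} E) w (insert v S) = sum w E2"
    using tree_weight_attained[OF conn'] by metis
  have fin: "finite E2" using 2(3) finite_edges by (auto simp: connected_graph_def)
  have "v \<in> V2" "V2 \<noteq> {v}" using S v 2(4) by blast+
  note rem = connected_subgraph_remove_pendant[OF sg v 2(1-3) this]
  have "tree_weight V E w (insert u S) \<le> sum w (E2 - {{u, v}})"
    using tree_weight_le[OF sg rem(3-5), of "insert u S" w] rem(2) 2(4) S(1) v by blast
  then show "w {u, v} + tree_weight V E w (insert u S)
      \<le> tree_weight (insert v V) (insert {u, v} E) w (insert v S)"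
    using 2(5) sum.remove[OF fin rem(1), of w] by simp
qed

section \<open>Weights of larger sets as minima over Steiner trees\<close>

text \<open>
  Every admissible \<open>X\<close> gives an upper bound for the weight of \<open>S\<close>, since subtrees joining its pairs
  unite to a connected subgraph around \<open>S\<close>.  The bound is attained by the edges of a lightest
  subtree around \<open>S\<close>, whose leaves lie in \<open>S\<close> because any other leaf could be removed.
\<close>

lemma tree_weight_eq_Min_steiner:
  assumes tree: "is_tree V E" and w: "\<And>e. e \<in> E \<Longrightarrow> 0 < w e" and S: "S \<subseteq> V" "2 \<le> card S"
  shows "tree_weight V E w S = Min ((\<lambda>X. \<Sum>I\<in>X. tree_weight V E w I) ` steiner_trees V S)"
proof -
  let ?t = "tree_weight V E w"
  have conn: "connected_graph V E" using tree by (simp add: is_tree_def)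
  then have sg: "simple_graph V E" by (simp add: connected_graph_def)
  then have finV: "finite V" by (simp add: simple_graph_def)
  have lower: "?t S \<le> (\<Sum>I\<in>X. ?t I)" if X: "X \<in> steiner_trees V S" for X
  proof -
    have XV: "\<And>I. I \<in> X \<Longrightarrow> I \<subseteq> V \<and> card I = 2" and Xtree: "is_tree (\<Union>X) X" and SX: "S \<subseteq> \<Union>X"
      using X by (auto simp: steiner_trees_def)
    have finX: "finite X" using finite_edges Xtree by (auto simp: is_tree_def connected_graph_def)
    have "\<exists>R. fst R \<subseteq> V \<and> snd R \<subseteq> E \<and> connected_graph (fst R) (snd R) \<and>
        I \<subseteq> fst R \<and> ?t I = sum w (snd R)" if "I \<in> X" for I
    proof -
      have "I \<subseteq> V" using XV that by blast
      then obtain V' E' where "V' \<subseteq> V" "E' \<subseteq> E" "connected_graph V' E'" "I \<subseteq> V'" "?t I = sum w E'"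
        by (rule tree_weight_attained[OF conn])
      then show ?thesis by (intro exI[of _ "(V', E')"]) simp
    qed
    then obtain R where R: "\<forall>I\<in>X. fst (R I) \<subseteq> V \<and> snd (R I) \<subseteq> E \<and>
        connected_graph (fst (R I)) (snd (R I)) \<and> I \<subseteq> fst (R I) \<and> ?t I = sum w (snd (R I))"
      using bchoice[of X "\<lambda>I R. fst R \<subseteq> V \<and> snd R \<subseteq> E \<and> connected_graph (fst R) (snd R) \<and>
        I \<subseteq> fst R \<and> ?t I = sum w (snd R)"] by blast
    define f where "f I = fst (R I)" for I
    define g where "g I = snd (R I)" for I
    have fg: "\<And>I. I \<in> X \<Longrightarrow> f I \<subseteq> V" "\<And>I. I \<in> X \<Longrightarrow> g I \<subseteq> E"
      "\<And>I. I \<in> X \<Longrightarrow> connected_graph (f I) (g I)" "\<And>I. I \<in> X \<Longrightarrow> I \<subseteq> f I"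
      "\<And>I. I \<in> X \<Longrightarrow> ?t I = sum w (g I)"
      using R by (auto simp: f_def g_def)
    let ?V = "\<Union>(f ` X)" and ?E = "\<Union>(g ` X)"
    have fin: "finite (g I)" if "I \<in> X" for I
      using fg(3)[OF that] finite_edges by (auto simp: connected_graph_def)
    \<comment> \<open>A walk in \<open>G\<^sub>X\<close> from \<open>c\<close> to a pair \<open>I\<close> lifts, edge by edge, to a walk in the union of the
      subtrees, which then continues inside the subtree of \<open>I\<close>.\<close>
    have within: "(x, y) \<in> (adjacent ?E)\<^sup>*" if "I \<in> X" "x \<in> f I" "y \<in> f I" for I x y
    proof -
      have "(x, y) \<in> (adjacent (g I))\<^sup>*" using fg(3) that by (auto simp: connected_graph_def)
      then show ?thesis by (rule adjacent_rtrancl_mono) (use that in blast)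
    qed
    have along: "(x, y) \<in> (adjacent ?E)\<^sup>*" if "(x, y) \<in> (adjacent X)\<^sup>*" for x y
      using that
    proof (induction rule: rtrancl_induct)
      case (step y z)
      then have "(y, z) \<in> (adjacent ?E)\<^sup>*" using within[of "{y, z}" y z] fg(4)[of "{y, z}"] by simp
      then show ?case using step.IH by (rule rtrancl_trans[rotated])
    qed simp
    obtain c where c: "c \<in> \<Union>X" using Xtree by (auto simp: is_tree_def connected_graph_def)
    have "connected_graph ?V ?E"
    proof (rule connected_graphI)
      show "simple_graph ?V ?E"
        unfolding simple_graph_def
      proof (intro conjI ballI)
        show "finite ?V" using finV fg(1) by (intro finite_subset[OF _ finV]) blast
        fix e assume "e \<in> ?E"
        then obtain I where "I \<in> X" "e \<in> g I" by blast
        moreover then have "simple_graph (f I) (g I)" using fg(3) by (simp add: connected_graph_def)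
        ultimately show "e \<subseteq> ?V" "card e = 2" by (auto simp: simple_graph_def)
      qed
      show "c \<in> ?V" using c fg(4) by blast
      fix x assume "x \<in> ?V"
      then obtain I where I: "I \<in> X" "x \<in> f I" by blast
      then have "I \<noteq> {}" using XV[OF I(1)] by auto
      then obtain y where y: "y \<in> I" by blast
      have "(c, y) \<in> (adjacent X)\<^sup>*"
        using Xtree c y I(1) unfolding is_tree_def connected_graph_def by blast
      then have "(c, y) \<in> (adjacent ?E)\<^sup>*" by (rule along)
      moreover have "(y, x) \<in> (adjacent ?E)\<^sup>*" using within[OF I(1) _ I(2)] fg(4)[OF I(1)] y by blast
      ultimately show "(c, x) \<in> (adjacent ?E)\<^sup>*" by (rule rtrancl_trans)
    qed
    moreover have "?V \<subseteq> V" by (intro UN_least fg(1))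
    moreover have "?E \<subseteq> E" by (intro UN_least fg(2))
    moreover have "\<Union>X \<subseteq> ?V" using fg(4) by (intro UN_mono[of X X id, simplified])
    then have "S \<subseteq> ?V" using SX by (rule subset_trans[rotated])
    ultimately have "?t S \<le> sum w ?E" by (intro tree_weight_le[OF sg])
    also have "\<dots> \<le> (\<Sum>I\<in>X. sum w (g I))"
    proof -
      \<comment> \<open>The subtrees may overlap; as weights are positive this only lowers the weight of the union.\<close>
      have "sum w (\<Union>(g ` Y)) \<le> (\<Sum>I\<in>Y. sum w (g I))" if "Y \<subseteq> X" for Y
        using finite_subset[OF that finX] that
      proof (induction Y rule: finite_induct)
        case (insert I Y)
        let ?B = "\<Union>(g ` Y)"
        have finB: "finite (g I)" "finite ?B" using fin insert.hyps insert.prems by auto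
        have "0 \<le> sum w (g I \<inter> ?B)"
          using fg(2)[of I] insert.prems w by (intro sum_nonneg less_imp_le) blast
        then have "sum w (g I \<union> ?B) \<le> sum w (g I) + sum w ?B"
          using sum.union_inter[OF finB, of w] by simp
        then show ?case using insert by simp
      qed simp
      then show ?thesis by blast
    qed
    also have "\<dots> = (\<Sum>I\<in>X. ?t I)" using fg(5) by simp
    finally show ?thesis .
  qed
  have attained: "\<exists>X \<in> steiner_trees V S. (\<Sum>I\<in>X. ?t I) \<le> ?t S"
  proof -
    obtain V' E' where sub: "V' \<subseteq> V" "E' \<subseteq> E" and conn': "connected_graph V' E'" and SV': "S \<subseteq> V'"
      and opt: "?t S = sum w E'"
      using tree_weight_attained[OF conn S(1)] by blast
    have sg': "simple_graph V' E'" using conn' by (simp add: connected_graph_def)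
    have finE': "finite E'" using finite_edges[OF sg'] .
    have "V' \<noteq> {v}" for v
      using SV' S(2) card_mono[of "{v}" S] by auto
    then have "\<exists>x. {x, v} \<in> E'" if "v \<in> V'" for v
      using connected_graph_ex_edge[OF conn' that] by blast
    then have cover: "\<Union>E' = V'"
      using sg' unfolding simple_graph_def by blast
    have leaves: "leaves V' E' \<subseteq> S"
    proof
      fix v assume "v \<in> leaves V' E'"
      then have v: "v \<in> V'" and one: "card {e \<in> E'. v \<in> e} = 1" by (auto simp: leaves_def)
      obtain e where e: "{e \<in> E'. v \<in> e} = {e}" using one by (auto simp: card_1_singleton_iff)
      then have eE: "e \<in> E'" "v \<in> e" by blast+
      then have "card e = 2" using sg' by (simp add: simple_graph_def)
      then obtain u where u: "e = {u, v}" using eE(2) by (auto simp: card_2_iff)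
      note rem = connected_graph_remove_pendant[OF conn' v e[unfolded u]]
      show "v \<in> S"
      proof (rule ccontr)
        assume "v \<notin> S"
        then have "?t S \<le> sum w (E' - {{u, v}})"
          using sub SV' by (intro tree_weight_le[OF sg _ _ rem(1)]) auto
        moreover have "sum w E' = w {u, v} + sum w (E' - {{u, v}})"
          using eE(1) u by (intro sum.remove finE') simp
        ultimately show False using opt w[of "{u, v}"] eE(1) u sub(2) by auto
      qed
    qed
    have "is_tree (\<Union>E') E'" using connected_subgraph_is_tree[OF tree conn' sub(2)] cover by simp
    then have "E' \<in> steiner_trees V S"
      using sg' sub SV' cover leaves by (auto simp: steiner_trees_def simple_graph_def)
    moreover have "(\<Sum>I\<in>E'. ?t I) \<le> sum w E'"
      using sub(2) tree_weight_edge_le[OF sg] by (intro sum_mono) blast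
    ultimately show ?thesis using opt by force
  qed
  let ?F = "(\<lambda>X. \<Sum>I\<in>X. ?t I) ` steiner_trees V S"
  have "finite ?F" using finite_steiner_trees[OF finV] by simp
  moreover obtain X where X: "X \<in> steiner_trees V S" "(\<Sum>I\<in>X. ?t I) \<le> ?t S" using attained by blast
  then have "?t S \<in> ?F" using lower[OF X(1)] by (intro image_eqI[OF _ X(1)]) simp
  ultimately show ?thesis using lower by (intro Min_eqI[symmetric]) auto
qed

section \<open>Metrics with the four-point condition and medians\<close>

text \<open>
  The four-point condition is written as one inequality over all quadruples; permuting the points
  recovers the statement that the maximum is attained twice.  Coinciding points are allowed
  throughout: for the inequality this makes the triangle inequality a special case, and a triple with
  a repeated point \<open>p\<close> has \<open>p\<close> as a median, so that triples need not be distinct when \<open>v\<close> is replaced by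
  \<open>u\<close> in the inductive steps.  Uniqueness of medians is a consequence (\<open>median_tree_metric_median_unique\<close>).
\<close>

definition median_tree_metric :: "'a set \<Rightarrow> ('a \<Rightarrow> 'a \<Rightarrow> real) \<Rightarrow> bool" where
  "median_tree_metric V d \<longleftrightarrow>
     (\<forall>x\<in>V. \<forall>y\<in>V. d x y = d y x \<and> d x x = 0 \<and> (x \<noteq> y \<longrightarrow> 0 < d x y)) \<and>
     (\<forall>a\<in>V. \<forall>b\<in>V. \<forall>x\<in>V. \<forall>y\<in>V. d a b + d x y \<le> max (d a x + d b y) (d a y + d b x)) \<and>
     (\<forall>a\<in>V. \<forall>b\<in>V. \<forall>c\<in>V. \<exists>m\<in>V.
        d a b = d a m + d m b \<and> d a c = d a m + d m c \<and> d b c = d b m + d m c)"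

lemma median_tree_metric_cong:
  assumes "\<And>x y. x \<in> V \<Longrightarrow> y \<in> V \<Longrightarrow> d x y = d' x y"
  shows "median_tree_metric V d \<longleftrightarrow> median_tree_metric V d'"
  unfolding median_tree_metric_def using assms by (simp cong: ball_cong bex_cong)

context
  fixes V :: "'a set" and d
  assumes mtm: "median_tree_metric V d"
begin

lemma mtm_sym: "x \<in> V \<Longrightarrow> y \<in> V \<Longrightarrow> d x y = d y x"
  and mtm_zero: "x \<in> V \<Longrightarrow> d x x = 0"
  and mtm_pos: "x \<in> V \<Longrightarrow> y \<in> V \<Longrightarrow> x \<noteq> y \<Longrightarrow> 0 < d x y"
  and mtm_four_point: "a \<in> V \<Longrightarrow> b \<in> V \<Longrightarrow> x \<in> V \<Longrightarrow> y \<in> V \<Longrightarrow>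
        d a b + d x y \<le> max (d a x + d b y) (d a y + d b x)"
  and mtm_median: "a \<in> V \<Longrightarrow> b \<in> V \<Longrightarrow> c \<in> V \<Longrightarrow>
        \<exists>m\<in>V. d a b = d a m + d m b \<and> d a c = d a m + d m c \<and> d b c = d b m + d m c"
  using mtm unfolding median_tree_metric_def by blast+

lemma mtm_nonneg: "x \<in> V \<Longrightarrow> y \<in> V \<Longrightarrow> 0 \<le> d x y"
  using mtm_zero mtm_pos by (cases "x = y") (auto intro: less_imp_le)

lemma mtm_triangle: "x \<in> V \<Longrightarrow> y \<in> V \<Longrightarrow> z \<in> V \<Longrightarrow> d x z \<le> d x y + d y z"
  using mtm_four_point[of x z y y] mtm_zero[of y] mtm_sym[of z y] by simp

text \<open>
  The distances from \<open>a\<close> and \<open>b\<close> to a median are determined by the three mutual distances, so \<open>m\<close> and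
  \<open>m'\<close> are at equal distances from \<open>a\<close> and \<open>b\<close>.  Then \<open>d a m + d b m'\<close> and \<open>d a m' + d b m\<close> both equal
  \<open>d a b\<close>, and the four-point condition bounds \<open>d a b + d m m'\<close> by this number.
\<close>

lemma median_tree_metric_median_unique:
  assumes V: "a \<in> V" "b \<in> V" "c \<in> V" "m \<in> V" "m' \<in> V"
    and m: "d a b = d a m + d m b" "d a c = d a m + d m c" "d b c = d b m + d m c"
    and m': "d a b = d a m' + d m' b" "d a c = d a m' + d m' c" "d b c = d b m' + d m' c"
  shows "m = m'"
proof (rule ccontr)
  assume "m \<noteq> m'"
  then have "0 < d m m'" using mtm_pos V by blast
  moreover have "d a m' = d a m" "d b m' = d b m"
    using m m' mtm_sym[of b m] mtm_sym[of b m'] V by auto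
  then have "d m m' \<le> 0" using mtm_four_point[of a b m m'] V m(1) mtm_sym[of b m] by auto
  ultimately show False by simp
qed

text \<open>
  Take \<open>v\<close> farthest from \<open>r\<close> and \<open>u\<close> nearest to \<open>v\<close>.  A median \<open>m\<close> of \<open>v\<close>, \<open>u\<close>, \<open>x\<close> lies between \<open>v\<close>
  and \<open>u\<close>, so it is one of the two by the choice of \<open>u\<close>.  If it is \<open>u\<close>, then \<open>u\<close> lies between \<open>v\<close> and
  \<open>x\<close>, as wanted.
\<close>

lemma median_tree_metric_pendant_exists:
  assumes "finite V" "r \<in> V" "V \<noteq> {r}"
  obtains u v where "u \<in> V" "v \<in> V" "u \<noteq> v" "\<forall>x\<in>V - {v}. d v x = d v u + d u x"
proof -
  have "Max (d r ` V) \<in> d r ` V" using assms by (intro Max_in) auto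
  then obtain v where v: "v \<in> V" and "Max (d r ` V) = d r v" by blast
  then have far: "d r x \<le> d r v" if "x \<in> V" for x
    using Max_ge[of "d r ` V" "d r x"] assms(1) that by simp
  have "V - {v} \<noteq> {}" using assms by auto
  then have "Min (d v ` (V - {v})) \<in> d v ` (V - {v})" using assms by (intro Min_in) auto
  then obtain u where u: "u \<in> V" "u \<noteq> v" and "Min (d v ` (V - {v})) = d v u" by blast
  then have near: "d v u \<le> d v x" if "x \<in> V - {v}" for x
    using Min_le[of "d v ` (V - {v})" "d v x"] assms(1) that by simp
  have "d v x = d v u + d u x" if x: "x \<in> V - {v}" for x
  proof -
    obtain m where m: "m \<in> V" "d v u = d v m + d m u" "d v x = d v m + d m x" "d u x = d u m + d m x"
      using mtm_median[of v u x] u(1) v x by blast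
    have "m = v \<or> m = u"
      using m near[of m] mtm_pos[of m u] u v by (cases "m = v") force+
    moreover have "m \<noteq> v"
    proof
      \<comment> \<open>Now \<open>v\<close> lies strictly between \<open>u\<close> and \<open>x\<close>, so \<open>d r v + d u x\<close> exceeds both other sums of
        the quadruple \<open>r\<close>, \<open>v\<close>, \<open>u\<close>, \<open>x\<close>, since \<open>r\<close> is at least as far from \<open>v\<close> as from \<open>u\<close> and \<open>x\<close>.\<close>
      assume "m = v"
      then have "d u x = d v u + d v x" using m(4) mtm_sym u(1) v by simp
      moreover have "0 < d v u" "0 < d v x" using mtm_pos u v x by auto
      moreover have "d r u \<le> d r v" "d r x \<le> d r v" using far u x by auto
      moreover have "d r v + d u x \<le> max (d r u + d v x) (d r x + d v u)"
        using mtm_four_point[of r v u x] assms(2) u v x by simp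
      ultimately show False by simp
    qed
    ultimately show ?thesis using m(3) by simp
  qed
  then show ?thesis using that u v by blast
qed

end

text \<open>
  Only medians can be lost by removing \<open>v\<close>.  But \<open>v\<close> is not a median of points other than \<open>v\<close>: the way
  from \<open>a\<close> to \<open>b\<close> through \<open>v\<close> runs twice along the edge to \<open>u\<close>.
\<close>

lemma median_tree_metric_remove_pendant:
  assumes mtm: "median_tree_metric V d" and V: "u \<in> V" "v \<in> V" "u \<noteq> v"
    and pendant: "\<forall>x\<in>V - {v}. d v x = d v u + d u x"
  shows "median_tree_metric (V - {v}) d"
  unfolding median_tree_metric_def
proof (intro conjI ballI)
  fix a b c assume abc: "a \<in> V - {v}" "b \<in> V - {v}" "c \<in> V - {v}"
  then obtain m where m: "m \<in> V"
    "d a b = d a m + d m b \<and> d a c = d a m + d m c \<and> d b c = d b m + d m c"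
    using mtm_median[OF mtm, of a b c] by blast
  have "m \<noteq> v"
  proof
    assume "m = v"
    then have "d a b = d v a + d v b" using m(2) mtm_sym[OF mtm, of a v] abc V by simp
    also have "\<dots> = 2 * d v u + (d a u + d u b)"
      using bspec[OF pendant abc(1)] bspec[OF pendant abc(2)] mtm_sym[OF mtm, of a u] abc V by simp
    also have "\<dots> > d a b"
      using mtm_triangle[OF mtm, of a u b] mtm_pos[OF mtm, of v u] abc V by simp
    finally show False by simp
  qed
  then show "\<exists>m\<in>V - {v}. d a b = d a m + d m b \<and> d a c = d a m + d m c \<and> d b c = d b m + d m c"
    using m by blast
qed (use mtm_sym[OF mtm] mtm_zero[OF mtm] mtm_pos[OF mtm] mtm_four_point[OF mtm] in blast)+

text \<open>
  Quadruples and triples in which the new vertex \<open>v\<close> occurs once behave as if \<open>u\<close> stood in its place,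
  up to the constant \<open>c\<close>, which enters both sides of each comparison that involves \<open>v\<close>.  If \<open>v\<close> occurs
  twice in a triple, then \<open>v\<close> itself is the median.
\<close>

lemma median_tree_metric_add_pendant:
  assumes mtm: "median_tree_metric V d" and u: "u \<in> V" and v: "v \<notin> V" and c: "0 < c"
    and new: "\<And>x. x \<in> V \<Longrightarrow> d v x = c + d u x" "\<And>x. x \<in> V \<Longrightarrow> d x v = d v x" "d v v = 0"
  shows "median_tree_metric (insert v V) d"
  unfolding median_tree_metric_def
proof (intro conjI ballI)
  note [simp] = mtm_zero[OF mtm] new(2,3)
  note nonneg = mtm_nonneg[OF mtm] and sym = mtm_sym[OF mtm]
  have d_sym: "d x y = d y x" if "x \<in> insert v V" "y \<in> insert v V" for x y
    using that sym[of x y] by auto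
  then show "d x y = d y x" if "x \<in> insert v V" "y \<in> insert v V" for x y
    using that by blast
  show "d x x = 0" if "x \<in> insert v V" for x
    using that by auto
  have new_pos: "0 < d v x" if "x \<in> V" for x
    using new(1)[OF that] nonneg[OF u that] c by simp
  show "x \<noteq> y \<longrightarrow> 0 < d x y" if "x \<in> insert v V" "y \<in> insert v V" for x y
    using that mtm_pos[OF mtm, of x y] new_pos[of x] new_pos[of y] by auto
  fix a b x y assume abxy: "a \<in> insert v V" "b \<in> insert v V" "x \<in> insert v V" "y \<in> insert v V"
  show "d a b + d x y \<le> max (d a x + d b y) (d a y + d b x)"
  proof (cases "a = x \<or> a = y \<or> b = x \<or> b = y")
    case True
    then show ?thesis using d_sym abxy by (elim disjE) (simp_all add: add.commute)
  next
    case False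
    \<comment> \<open>All four distances on the right are between distinct points, so there the formula
      \<open>d p q = len p + len q + d (proj p) (proj q)\<close> is exact.  On the left a pair may be \<open>v\<close>, \<open>v\<close>, and
      the formula is an upper bound.\<close>
    define proj where "proj z = (if z = v then u else z)" for z
    define len where "len z = (if z = v then c else 0)" for z
    have proj: "proj z \<in> V" if "z \<in> insert v V" for z using that u by (auto simp: proj_def)
    have eq: "d p q = len p + len q + d (proj p) (proj q)"
      if "p \<in> insert v V" "q \<in> insert v V" "p \<noteq> q" for p q
      using that new(1)[of p] new(1)[of q] sym[of u p] u by (auto simp: proj_def len_def)
    have le: "d p q \<le> len p + len q + d (proj p) (proj q)"
      if "p \<in> insert v V" "q \<in> insert v V" for p q
      using that eq[OF that] c u by (cases "p = q") (auto simp: proj_def len_def)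
    show ?thesis
      using le[of a b] le[of x y] eq[of a x] eq[of b y] eq[of a y] eq[of b x] abxy False
        mtm_four_point[OF mtm proj proj proj proj, of a b x y]
      by (simp add: max_def split: if_splits)
  qed
next
  note [simp] = mtm_zero[OF mtm] new(2,3)
  have one_new: "\<exists>m\<in>V. d v b = d v m + d m b \<and> d v c = d v m + d m c \<and> d b c = d b m + d m c"
    if bc: "b \<in> V" "c \<in> V" for b c
    using mtm_median[OF mtm u bc] new(1) bc by (auto simp: add.assoc)
  fix a b c assume abc: "a \<in> insert v V" "b \<in> insert v V" "c \<in> insert v V"
  consider "a = v \<and> b = v \<or> a = v \<and> c = v \<or> b = v \<and> c = v"
    | "a \<in> V" "b \<in> V" "c \<in> V" | "a = v" "b \<in> V" "c \<in> V"
    | "b = v" "a \<in> V" "c \<in> V" | "c = v" "a \<in> V" "b \<in> V"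
    using abc by blast
  then show "\<exists>m\<in>insert v V. d a b = d a m + d m b \<and> d a c = d a m + d m c \<and> d b c = d b m + d m c"
  proof cases
    case 1
    then show ?thesis using abc by (intro bexI[of _ v]) auto
  next
    case 2
    then show ?thesis using mtm_median[OF mtm 2] by blast
  next
    case 3
    then show ?thesis using one_new[of b c] by blast
  next
    case 4
    then obtain m where "m \<in> V" "d v a = d v m + d m a" "d v c = d v m + d m c" "d a c = d a m + d m c"
      using one_new[of a c] by blast
    then show ?thesis using 4 mtm_sym[OF mtm, of m a] by (intro bexI[of _ m]) auto
  next
    case 5
    then obtain m where "m \<in> V" "d v a = d v m + d m a" "d v b = d v m + d m b" "d a b = d a m + d m b"
      using one_new[of a b] by blast
    then show ?thesis using 5 mtm_sym[OF mtm, of m a] mtm_sym[OF mtm, of m b]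
      by (intro bexI[of _ m]) auto
  qed
qed

section \<open>Path metrics of labelled trees\<close>

lemma tree_weight_median_tree_metric:
  assumes "is_tree V E" "\<And>e. e \<in> E \<Longrightarrow> 0 < w e"
  shows "median_tree_metric V (\<lambda>x y. tree_weight V E w {x, y})"
  using assms
proof (induction rule: tree_induct)
  case (singleton r)
  have "tree_weight {r} {} w {r} = 0"
    by (rule tree_weight_singleton[OF connected_graph_singleton]) simp_all
  then show ?case by (simp add: median_tree_metric_def)
next
  case (pendant V E u v)
  have conn: "connected_graph V E" using pendant.hyps(1) by (simp add: is_tree_def)
  let ?d = "\<lambda>x y. tree_weight (insert v V) (insert {u, v} E) w {x, y}"
  have old: "?d x y = tree_weight V E w {x, y}" if "x \<in> V" "y \<in> V" for x y
    using that pendant.hyps(2,3) pendant.prems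
    by (intro tree_weight_avoiding_pendant[OF conn]) simp_all
  have "median_tree_metric V (\<lambda>x y. tree_weight V E w {x, y})"
    using pendant.prems by (intro pendant.IH) simp
  then have "median_tree_metric V ?d"
    using median_tree_metric_cong[of V ?d "\<lambda>x y. tree_weight V E w {x, y}", OF old] by simp
  then show ?case
  proof (rule median_tree_metric_add_pendant)
    show "u \<in> V" "v \<notin> V" "0 < w {u, v}" using pendant.hyps pendant.prems by simp_all
    show "?d v x = w {u, v} + ?d u x" if "x \<in> V" for x
      using tree_weight_at_pendant[OF conn pendant.hyps(2,3), of "{x}" w] that
        old[OF pendant.hyps(2) that] by simp
    show "?d x v = ?d v x" for x by (simp add: insert_commute)
    show "?d v v = 0"
      using tree_weight_singleton[OF connected_graph_add_pendant[OF conn pendant.hyps(2,3)], of v w]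
        pendant.prems by simp
  qed
qed

text \<open>
  The edge weights are the values of \<open>D\<close> itself, so only the edge set is built up by the recursion.
\<close>

lemma median_tree_metric_realised:
  assumes "finite V" "V \<noteq> {}" "median_tree_metric V (pair_dist D)"
  shows "\<exists>E. positive_weighted_tree V E D \<and>
           (\<forall>x\<in>V. \<forall>y\<in>V. tree_weight V E D {x, y} = pair_dist D x y)"
  using assms
proof (induction "card V" arbitrary: V rule: less_induct)
  case less
  obtain r where r: "r \<in> V" using less.prems(2) by blast
  show ?case
  proof (cases "V = {r}")
    case True
    have "tree_weight {r} {} D {r} = 0"
      by (rule tree_weight_singleton[OF connected_graph_singleton]) simp_all
    then show ?thesis using True
      by (intro exI[of _ "{}"]) (simp add: positive_weighted_tree_def is_tree_singleton pair_dist_def)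
  next
    case False
    note mtm = less.prems(3)
    from median_tree_metric_pendant_exists[OF mtm less.prems(1) r False]
    obtain u v where uv: "u \<in> V" "v \<in> V" "u \<noteq> v"
      and pendant: "\<forall>x\<in>V - {v}. pair_dist D v x = pair_dist D v u + pair_dist D u x" .
    let ?V = "V - {v}"
    have V: "insert v ?V = V" and u: "u \<in> ?V" and v: "v \<notin> ?V" using uv by auto
    have "card ?V < card V" using uv(2) less.prems(1) by (intro psubset_card_mono) auto
    moreover have "median_tree_metric ?V (pair_dist D)"
      by (rule median_tree_metric_remove_pendant[OF mtm uv pendant])
    moreover have "finite ?V" "?V \<noteq> {}" using less.prems(1) u by auto
    ultimately have "\<exists>E. positive_weighted_tree ?V E D \<and>
        (\<forall>x\<in>?V. \<forall>y\<in>?V. tree_weight ?V E D {x, y} = pair_dist D x y)"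
      by (intro less.hyps)
    then obtain E where E: "positive_weighted_tree ?V E D"
      and dist: "\<And>x y. x \<in> ?V \<Longrightarrow> y \<in> ?V \<Longrightarrow> tree_weight ?V E D {x, y} = pair_dist D x y"
      by blast
    let ?E = "insert {u, v} E"
    have uv_dist: "pair_dist D v u = D {u, v}" using uv(3) by (simp add: pair_dist_def insert_commute)
    have pos: "0 < D e" if "e \<in> ?E" for e
      using that E mtm_pos[OF mtm uv(2,1)] uv(3) uv_dist by (auto simp: positive_weighted_tree_def)
    have tree: "is_tree ?V E" using E by (simp add: positive_weighted_tree_def)
    then have conn: "connected_graph ?V E" by (simp add: is_tree_def)
    have tree': "is_tree V ?E" using is_tree_add_pendant[OF tree u v] V by simp
    have new: "tree_weight V ?E D {v, x} = pair_dist D v x" if "x \<in> ?V" for x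
      using tree_weight_at_pendant[OF conn u v, of "{x}" D] that dist[OF u that] bspec[OF pendant that]
        uv_dist V by simp
    have old: "tree_weight V ?E D {x, y} = pair_dist D x y" if "x \<in> ?V" "y \<in> ?V" for x y
      using tree_weight_avoiding_pendant[OF conn u v, of "{x, y}" D] that dist pos V by simp
    have "tree_weight V ?E D {v, v} = 0"
      using tree_weight_singleton[of V ?E v D] tree' uv(2) pos by (simp add: is_tree_def)
    then have all_v: "tree_weight V ?E D {v, x} = pair_dist D v x" if "x \<in> V" for x
      using that new[of x] by (cases "x = v") (simp_all add: pair_dist_def)
    have "tree_weight V ?E D {x, y} = pair_dist D x y" if xy: "x \<in> V" "y \<in> V" for x y
    proof -
      consider "x = v" | "y = v" | "x \<in> ?V" "y \<in> ?V" using xy by blast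
      then show ?thesis
      proof cases
        case 1
        then show ?thesis using all_v xy(2) by simp
      next
        case 2
        then show ?thesis using all_v[OF xy(1)] by (simp add: insert_commute[of x v] pair_dist_def)
      next
        case 3
        then show ?thesis by (rule old)
      qed
    qed
    then show ?thesis using tree' pos by (auto simp: positive_weighted_tree_def)
  qed
qed

section \<open>Characterisation of the weight families of labelled trees\<close>

lemma max_attained_twice_iff:
  "max_attained_twice x y z \<longleftrightarrow> x \<le> max y z \<and> y \<le> max x z \<and> z \<le> max x y"
  by (auto simp: max_attained_twice_def max_def)

lemma pair_dist_commute: "pair_dist D x y = pair_dist D y x"
  by (simp add: pair_dist_def insert_commute)

lemma four_point_median_iff:
  assumes pos: "\<And>x y. x \<in> V \<Longrightarrow> y \<in> V \<Longrightarrow> x \<noteq> y \<Longrightarrow> 0 < D {x, y}"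
  shows "four_point V D \<and> median_family V D \<longleftrightarrow> median_tree_metric V (pair_dist D)"
    (is "?L \<longleftrightarrow> ?R")
proof
  assume ?L
  then have quartets: "four_point V D" and medians: "median_family V D" by blast+
  let ?d = "pair_dist D"
  have zero [simp]: "?d x x = 0" for x by (simp add: pair_dist_def)
  show ?R
    unfolding median_tree_metric_def
  proof (intro conjI ballI)
    fix x y assume "x \<in> V" "y \<in> V"
    then show "x \<noteq> y \<longrightarrow> 0 < ?d x y" using pos by (simp add: pair_dist_def)
  next
    fix a b x y assume "a \<in> V" "b \<in> V" "x \<in> V" "y \<in> V"
    then show "?d a b + ?d x y \<le> max (?d a x + ?d b y) (?d a y + ?d b x)"
      using quartets unfolding four_point_def max_attained_twice_iff by blast
  next
    fix a b c assume V: "a \<in> V" "b \<in> V" "c \<in> V"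
    show "\<exists>m\<in>V. ?d a b = ?d a m + ?d m b \<and> ?d a c = ?d a m + ?d m c \<and> ?d b c = ?d b m + ?d m c"
    proof (cases "a \<noteq> b \<and> a \<noteq> c \<and> b \<noteq> c")
      case True
      then obtain m where m: "m \<in> V"
        "\<forall>i\<in>{a, b, c}. \<forall>j\<in>{a, b, c}. i \<noteq> j \<longrightarrow> ?d i j = ?d i m + ?d j m"
        using medians V unfolding median_family_def by blast
      have "?d a b = ?d a m + ?d b m" "?d a c = ?d a m + ?d c m" "?d b c = ?d b m + ?d c m"
        using m(2) True by blast+
      then show ?thesis
        using m(1) pair_dist_commute[of D m b] pair_dist_commute[of D m c]
        by (intro bexI[of _ m]) simp_all
    next
      case False
      then consider "a = b" | "a = c" | "b = c" by blast
      then show ?thesis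
      proof cases
        case 1
        then show ?thesis using V by (intro bexI[of _ a]) simp_all
      next
        case 2
        then show ?thesis using V pair_dist_commute[of D b c] by (intro bexI[of _ a]) simp_all
      next
        case 3
        then show ?thesis using V by (intro bexI[of _ b]) simp_all
      qed
    qed
  qed (use pair_dist_commute[of D] in simp_all)
next
  let ?d = "pair_dist D"
  assume mtm: ?R
  show ?L
  proof
    show "four_point V D"
      unfolding four_point_def max_attained_twice_iff
    proof (intro ballI)
      fix a b c e assume V: "a \<in> V" "b \<in> V" "c \<in> V" "e \<in> V"
      show "?d a b + ?d c e \<le> max (?d a c + ?d b e) (?d a e + ?d b c) \<and>
            ?d a c + ?d b e \<le> max (?d a b + ?d c e) (?d a e + ?d b c) \<and>
            ?d a e + ?d b c \<le> max (?d a b + ?d c e) (?d a c + ?d b e)"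
        using mtm_four_point[OF mtm V] mtm_four_point[OF mtm V(1,3,2,4)]
          mtm_four_point[OF mtm V(1,4,2,3)] pair_dist_commute[of D c b]
          pair_dist_commute[of D e b] pair_dist_commute[of D e c]
        by (simp add: max.commute)
    qed
    show "median_family V D"
      unfolding median_family_def
    proof (intro ballI impI)
      fix a b c assume V: "a \<in> V" "b \<in> V" "c \<in> V" and ne: "a \<noteq> b \<and> a \<noteq> c \<and> b \<noteq> c"
      have iff: "(\<forall>i\<in>{a, b, c}. \<forall>j\<in>{a, b, c}. i \<noteq> j \<longrightarrow> ?d i j = ?d i m + ?d j m) \<longleftrightarrow>
          ?d a b = ?d a m + ?d m b \<and> ?d a c = ?d a m + ?d m c \<and> ?d b c = ?d b m + ?d m c" for m
        using ne by (auto simp: pair_dist_commute[of D m] pair_dist_commute[of D b a]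
            pair_dist_commute[of D c a] pair_dist_commute[of D c b])
      show "\<exists>!m. m \<in> V \<and> (\<forall>i\<in>{a, b, c}. \<forall>j\<in>{a, b, c}. i \<noteq> j \<longrightarrow> ?d i j = ?d i m + ?d j m)"
        unfolding iff
      proof (rule ex_ex1I)
        show "\<exists>m. m \<in> V \<and> ?d a b = ?d a m + ?d m b \<and> ?d a c = ?d a m + ?d m c \<and>
            ?d b c = ?d b m + ?d m c"
          using mtm_median[OF mtm V] by blast
      qed (elim conjE, rule median_tree_metric_median_unique[OF mtm V])
    qed
  qed
qed

theorem theorem12:
  fixes n :: nat and D :: "nat set \<Rightarrow> real"
  assumes "3 \<le> n"
    and "\<And>I. I \<subseteq> {1..n} \<Longrightarrow> 2 \<le> card I \<Longrightarrow> 0 < D I"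
  shows "(\<exists>E w. positive_weighted_tree {1..n} E w \<and>
            (\<forall>I. I \<subseteq> {1..n} \<and> 2 \<le> card I \<longrightarrow> tree_weight {1..n} E w I = D I)) \<longleftrightarrow>
         (four_point {1..n} D \<and>
          median_family {1..n} D \<and>
          (\<forall>S. S \<subseteq> {1..n} \<and> 3 \<le> card S \<longrightarrow>
             D S = Min ((\<lambda>X. \<Sum>I\<in>X. D I) ` steiner_trees {1..n} S)))"
    (is "?tree \<longleftrightarrow> ?cond")
proof -
  let ?A = "{1..n}"
  have pos: "0 < D {x, y}" if "x \<in> ?A" "y \<in> ?A" "x \<noteq> y" for x y
    using assms(2)[of "{x, y}"] that by simp
  note iff = four_point_median_iff[of ?A D, OF pos]
  have steiner: "tree_weight ?A E w S = Min ((\<lambda>X. \<Sum>I\<in>X. D I) ` steiner_trees ?A S)"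
    if "positive_weighted_tree ?A E w" "S \<subseteq> ?A" "3 \<le> card S"
      and pairs: "\<And>I. I \<subseteq> ?A \<Longrightarrow> card I = 2 \<Longrightarrow> tree_weight ?A E w I = D I" for E w S
  proof -
    have "tree_weight ?A E w S = Min ((\<lambda>X. \<Sum>I\<in>X. tree_weight ?A E w I) ` steiner_trees ?A S)"
      using that by (intro tree_weight_eq_Min_steiner) (auto simp: positive_weighted_tree_def)
    also have "(\<lambda>X. \<Sum>I\<in>X. tree_weight ?A E w I) ` steiner_trees ?A S =
        (\<lambda>X. \<Sum>I\<in>X. D I) ` steiner_trees ?A S"
      using pairs by (intro image_cong sum.cong) (auto simp: steiner_trees_def)
    finally show ?thesis .
  qed
  show ?thesis
  proof
    assume ?tree
    then obtain E w where T: "positive_weighted_tree ?A E w"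
      and real: "\<And>I. I \<subseteq> ?A \<Longrightarrow> 2 \<le> card I \<Longrightarrow> tree_weight ?A E w I = D I" by blast
    have tree: "is_tree ?A E" and w: "\<And>e. e \<in> E \<Longrightarrow> 0 < w e"
      using T by (auto simp: positive_weighted_tree_def)
    have "tree_weight ?A E w {x, y} = pair_dist D x y" if "x \<in> ?A" "y \<in> ?A" for x y
      using that real[of "{x, y}"] tree_weight_singleton[of ?A E x w] tree w
      by (cases "x = y") (auto simp: pair_dist_def is_tree_def)
    then have "median_tree_metric ?A (\<lambda>x y. tree_weight ?A E w {x, y}) \<longleftrightarrow>
        median_tree_metric ?A (pair_dist D)"
      by (rule median_tree_metric_cong)
    then have "four_point ?A D \<and> median_family ?A D"
      using tree_weight_median_tree_metric[OF tree w] iff by simp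
    moreover have "D S = Min ((\<lambda>X. \<Sum>I\<in>X. D I) ` steiner_trees ?A S)"
      if "S \<subseteq> ?A" "3 \<le> card S" for S
      using steiner[OF T that real] real[OF that(1)] that(2) by simp
    ultimately show ?cond by simp
  next
    assume cond: ?cond
    then have "median_tree_metric ?A (pair_dist D)" using iff by blast
    then obtain E where T: "positive_weighted_tree ?A E D"
      and dist: "\<And>x y. x \<in> ?A \<Longrightarrow> y \<in> ?A \<Longrightarrow> tree_weight ?A E D {x, y} = pair_dist D x y"
      using median_tree_metric_realised[of ?A D] assms(1) by auto
    have pairs: "tree_weight ?A E D I = D I" if I: "I \<subseteq> ?A" "card I = 2" for I
    proof -
      obtain x y where "I = {x, y}" "x \<noteq> y" using I(2) by (auto simp: card_2_iff)
      then show ?thesis using dist[of x y] I(1) by (simp add: pair_dist_def)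
    qed
    have "tree_weight ?A E D I = D I" if I: "I \<subseteq> ?A" "2 \<le> card I" for I
    proof (cases "card I = 2")
      case True
      then show ?thesis using pairs I(1) by blast
    next
      case False
      then have "3 \<le> card I" using I(2) by simp
      then show ?thesis using steiner[OF T I(1) \<open>3 \<le> card I\<close> pairs] cond I(1) by simp
    qed
    then show ?tree using T by blast
  qed
qed

end
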